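(* Let $G=\langle V\cup\{s\},E\rangle$ be a weighted undirected graph with source $s$ and edge costs $c_{(i,j)}\ge 0$. The average marginal cost mechanism (AMCM) $(g,f,x)$ satisfies truthfulness: for every node $i\in V$, every type $\theta_i\in\Theta_i$, every report $\theta_i'\in\Theta_i$ with $\theta_i'\subseteq\theta_i$, and every profile $\theta_{-i}'\in\Theta_{-i}$ of the other nodes (including $s$) such that $i\in g(\theta_i,\theta_{-i}')\cap g(\theta_i',\theta_{-i}')$, $$x_i((\theta_i,\theta_{-i}'))\le x_i((\theta_i',\theta_{-i}')).$$
   Context: Setting. $G=\langle V\cup\{s\},E\rangle$ is a finite weighted undirected graph; $s$ is the source, and each edge $(i,j)\in E$ has cost $c_{(i,j)}\ge 0$. For $i\in V\cup\{s\}$, a type of $i$ is a set of edges of $E$ adjacent to $i$; $\Theta_i$ is the set of all such sets. $\Theta=\prod_{i\in V\cup\{s\}}\Theta_i$ and $\Theta_{-i}=\prod_{j\neq i}\Theta_j$. A node $i\in V$ with type $\theta_i$ may report any $\theta_i'\subseteq\theta_i$ (the source is not strategic). A report profile $\theta'\in\Theta$ induces the graph $G_{\theta'}=\langle V\cup\{s\},E_{\theta'}\rangle$ with $E_{\theta'}=\{(i,j)\in E : (i,j)\in\theta_i'\cap\theta_j'\}$. A cost sharing mechanism $(g,f,x)$ assigns to each $\theta'\in\Theta$ a set $g(\theta')\subseteq V$ of selected (connected) nodes, a set $f(\theta')\subseteq E_{\theta'}$ of selected edges connecting the nodes of $g(\theta')$ (to the source), and cost shares $x_i(\theta')\in\mathbb{R}$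 for $i\in V$, with $x_i(\theta')=0$ if $i\notin g(\theta')$. AMCM. Given $\theta'\in\Theta$: compute, by Prim's algorithm started at $s$, a minimum spanning tree (of the connected component of $s$) in $G_{\theta'}$. Let $g(\theta')$ be the set of nodes other than $s$ in this tree (i.e. the nodes of $V$ connected to $s$ in $G_{\theta'}$) and $f(\theta')$ its edge set. For $S\subseteq g(\theta')$ let $v(S)$ be the minimum cost to connect $S$ to $s$ in $G_{\theta'}$, i.e. the minimum total edge cost of a connected subgraph of $G_{\theta'}$ containing $S\cup\{s\}$ (nodes outside $S$ may be used as intermediate nodes; $v(\emptyset)=0$). For $i\in g(\theta')$ set $$x_i(\theta')=\sum_{S\subseteq g(\theta')\setminus\{i\}}\frac{|S|!\,(|g(\theta')|-|S|-1)!}{|g(\theta')|!}\,\bigl(v(S\cup\{i\})-v(S)\bigr),$$ and $x_i(\theta')=0$ for $i\in V\setminus g(\theta')$. *)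

theory Defs
  imports Complex_Main "HOL-Library.FuncSet"
begin

text \<open>
  An undirected edge \<open>(i, j)\<close> is the set \<open>{i, j}\<close>; costs are a function on edges. Loops \<open>{i, i}\<close> are
  not excluded.
\<close>

definition weighted_graph :: "'a set \<Rightarrow> 'a \<Rightarrow> 'a set set \<Rightarrow> ('a set \<Rightarrow> real) \<Rightarrow> bool" where
  "weighted_graph V s E c \<longleftrightarrow>
     finite V \<and> s \<notin> V \<and>
     E \<subseteq> {{i, j} | i j. i \<in> insert s V \<and> j \<in> insert s V} \<and>
     (\<forall>e\<in>E. c e \<ge> 0)"

definition types :: "'a set set \<Rightarrow> 'a \<Rightarrow> 'a set set set" where
  "types E i = Pow {e \<in> E. i \<in> e}"

definition profiles :: "'a set \<Rightarrow> 'a \<Rightarrow> 'a set set \<Rightarrow> ('a \<Rightarrow> 'a set set) set" where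
  "profiles V s E = (\<Pi>\<^sub>E i\<in>insert s V. types E i)"

definition profiles_except ::
    "'a set \<Rightarrow> 'a \<Rightarrow> 'a set set \<Rightarrow> 'a \<Rightarrow> ('a \<Rightarrow> 'a set set) set" where
  "profiles_except V s E i = (\<Pi>\<^sub>E j\<in>insert s V - {i}. types E j)"

definition induced_edges :: "'a set set \<Rightarrow> ('a \<Rightarrow> 'a set set) \<Rightarrow> 'a set set" where
  "induced_edges E \<theta> = {{i, j} | i j. {i, j} \<in> E \<and> {i, j} \<in> \<theta> i \<inter> \<theta> j}"

definition cut_edges :: "'a set set \<Rightarrow> 'a set \<Rightarrow> 'a set set" where
  "cut_edges H U = {{u, w} | u w. u \<in> U \<and> w \<notin> U \<and> {u, w} \<in> H}"

text \<open>
  \<open>prim_reach H c s U T\<close>: Prim's algorithm, started at \<open>s\<close> on the graph with edge set \<open>H\<close>, can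
  arrive at the tree with node set \<open>U\<close> and edge set \<open>T\<close>. It is a relation because ties between
  cheapest cut edges may be broken arbitrarily.
\<close>

inductive prim_reach ::
    "'a set set \<Rightarrow> ('a set \<Rightarrow> real) \<Rightarrow> 'a \<Rightarrow> 'a set \<Rightarrow> 'a set set \<Rightarrow> bool"
  for H :: "'a set set" and c :: "'a set \<Rightarrow> real" and s :: 'a where
  start: "prim_reach H c s {s} {}"
| step: "prim_reach H c s U T \<Longrightarrow> u \<in> U \<Longrightarrow> w \<notin> U \<Longrightarrow> {u, w} \<in> H \<Longrightarrow>
    (\<forall>e\<in>cut_edges H U. c {u, w} \<le> c e) \<Longrightarrow>
    prim_reach H c s (insert w U) (insert {u, w} T)"

definition prim_output ::
    "'a set set \<Rightarrow> ('a set \<Rightarrow> real) \<Rightarrow> 'a \<Rightarrow> 'a set \<Rightarrow> 'a set set \<Rightarrow> bool" where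
  "prim_output H c s U T \<longleftrightarrow> prim_reach H c s U T \<and> cut_edges H U = {}"

definition connected_subgraph ::
    "'a set \<Rightarrow> 'a set set \<Rightarrow> 'a set \<Rightarrow> 'a set set \<Rightarrow> bool" where
  "connected_subgraph N H W F \<longleftrightarrow>
     W \<subseteq> N \<and> F \<subseteq> H \<and> \<Union>F \<subseteq> W \<and> W \<noteq> {} \<and>
     (\<forall>u\<in>W. \<forall>w\<in>W. (u, w) \<in> {(a, b). {a, b} \<in> F}\<^sup>*)"

text \<open>
  The minimum is over a finite set, which is nonempty whenever every node of \<open>S\<close> is connected to
  \<open>s\<close>; only such \<open>S\<close> occur below. For \<open>S = {}\<close> the subgraph \<open>({s}, {})\<close> gives the value \<open>0\<close>.
\<close>

definition connection_cost ::
    "'a set \<Rightarrow> 'a \<Rightarrow> 'a set set \<Rightarrow> ('a set \<Rightarrow> real) \<Rightarrow> ('a \<Rightarrow> 'a set set) \<Rightarrow> 'a set \<Rightarrow> real" where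
  "connection_cost V s E c \<theta> S =
     Min {(\<Sum>e\<in>F. c e) | W F.
       connected_subgraph (insert s V) (induced_edges E \<theta>) W F \<and> insert s S \<subseteq> W}"

text \<open>
  \<open>AMCM V s E c g f x\<close> says that \<open>(g, f, x)\<close> is the average marginal cost mechanism for some
  (arbitrary) resolution of the ties in Prim's algorithm.
\<close>

definition AMCM ::
    "'a set \<Rightarrow> 'a \<Rightarrow> 'a set set \<Rightarrow> ('a set \<Rightarrow> real) \<Rightarrow>
     (('a \<Rightarrow> 'a set set) \<Rightarrow> 'a set) \<Rightarrow> (('a \<Rightarrow> 'a set set) \<Rightarrow> 'a set set) \<Rightarrow>
     ('a \<Rightarrow> ('a \<Rightarrow> 'a set set) \<Rightarrow> real) \<Rightarrow> bool" where
  "AMCM V s E c g f x \<longleftrightarrow>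
     (\<forall>\<theta>\<in>profiles V s E.
        (\<exists>U. prim_output (induced_edges E \<theta>) c s U (f \<theta>) \<and> g \<theta> = U - {s}) \<and>
        (\<forall>i\<in>V. x i \<theta> =
           (if i \<in> g \<theta> then
              (\<Sum>S\<in>Pow (g \<theta> - {i}).
                 fact (card S) * fact (card (g \<theta>) - card S - 1) / fact (card (g \<theta>)) *
                 (connection_cost V s E c \<theta> (insert i S) - connection_cost V s E c \<theta> S))
            else 0)))"

text \<open>Prim's algorithm always terminates on a finite graph, so such a mechanism exists.\<close>

lemma prim_output_exists:
  assumes "finite H" "\<And>e. e \<in> H \<Longrightarrow> finite e"
  shows "\<exists>U T. prim_output H c s U T"
proof (rule ccontr)
  assume none: "\<not> ?thesis"
  let ?N = "insert s (\<Union>H)"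
  have sub: "U \<subseteq> ?N" if "prim_reach H c s U T" for U T
    using that by (induction rule: prim_reach.induct) auto
  have fin: "finite ?N" using assms by auto
  have "\<exists>U T. prim_reach H c s U T \<and> card U = Suc n" for n
  proof (induction n)
    case 0
    show ?case by (rule exI[of _ "{s}"], rule exI[of _ "{}"]) (simp add: prim_reach.start)
  next
    case (Suc n)
    then obtain U T where UT: "prim_reach H c s U T" "card U = Suc n" by blast
    have ne: "cut_edges H U \<noteq> {}" using UT none by (auto simp: prim_output_def)
    have fc: "finite (cut_edges H U)"
      by (rule finite_subset[OF _ assms(1)]) (auto simp: cut_edges_def)
    obtain e where e: "e \<in> cut_edges H U" "\<forall>e'\<in>cut_edges H U. c e \<le> c e'"
      using ex_min_if_finite[of "c ` cut_edges H U"] fc ne by (auto simp: not_less)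
    then obtain u w where uw: "e = {u, w}" "u \<in> U" "w \<notin> U" "{u, w} \<in> H"
      unfolding cut_edges_def by blast
    have "prim_reach H c s (insert w U) (insert {u, w} T)"
      using prim_reach.step[OF UT(1) uw(2-4)] e(2) uw(1) by simp
    moreover have "finite U" using UT(2) by (simp add: card_ge_0_finite)
    then have "card (insert w U) = Suc (Suc n)" using UT(2) uw(3) by simp
    ultimately show ?case by blast
  qed
  then obtain U T where "prim_reach H c s U T" "card U = Suc (card ?N)" by blast
  with card_mono[OF fin sub] show False by fastforce
qed

lemma AMCM_exists:
  assumes "weighted_graph V s E c"
  shows "\<exists>g f x. AMCM V s E c g f x"
proof -
  have finE: "finite E"
  proof (rule finite_subset)
    show "E \<subseteq> Pow (insert s V)" using assms unfolding weighted_graph_def by blast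
    show "finite (Pow (insert s V))" using assms by (simp add: weighted_graph_def)
  qed
  have "\<exists>U T. prim_output (induced_edges E \<theta>) c s U T" for \<theta>
  proof (rule prim_output_exists)
    show "finite (induced_edges E \<theta>)"
      by (rule finite_subset[OF _ finE]) (auto simp: induced_edges_def)
  qed (auto simp: induced_edges_def)
  then obtain U T where UT: "\<And>\<theta>. prim_output (induced_edges E \<theta>) c s (U \<theta>) (T \<theta>)"
    by metis
  show ?thesis
    unfolding AMCM_def
    by (rule exI[of _ "\<lambda>\<theta>. U \<theta> - {s}"], rule exI[of _ T]) (use UT in fast)
qed

end

theory Submission
  imports Defs
begin

text \<open>
  Shrinking the report of \<open>i\<close> only deletes edges at \<open>i\<close>. If an optimal subgraph for \<open>S\<close> in the
  larger graph contains \<open>i\<close>, the marginal cost of \<open>i\<close> there is \<open>0\<close>; otherwise that subgraph survives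
  the deletion, so \<open>v(S)\<close> is unchanged while \<open>v(S \<union> {i})\<close> can only grow. Nodes that lose their
  connection hang off \<open>i\<close>, so coalitions containing one of them contribute \<open>0\<close> in the larger graph.
  The remaining coalitions have nonnegative marginal costs, and their Shapley weights can only grow
  when the number of players drops.
\<close>

text \<open>Depends on the edge set rather than on the report profile, so that two nested edge sets
  can be compared directly; the source is just one of the terminals in \<open>A\<close>.\<close>

definition steiner_cost :: "'a set \<Rightarrow> 'a set set \<Rightarrow> ('a set \<Rightarrow> real) \<Rightarrow> 'a set \<Rightarrow> real" where
  "steiner_cost N H c A =
     Min {(\<Sum>e\<in>F. c e) | W F. connected_subgraph N H W F \<and> A \<subseteq> W}"

lemma connection_cost_eq_steiner_cost:
  "connection_cost V s E c \<theta> S = steiner_cost (insert s V) (induced_edges E \<theta>) c (insert s S)"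
  by (simp add: connection_cost_def steiner_cost_def)

lemma finite_steiner_costs:
  assumes "finite H"
  shows "finite {(\<Sum>e\<in>F. c e) | W F. connected_subgraph N H W F \<and> A \<subseteq> W}"
proof (rule finite_subset)
  show "{(\<Sum>e\<in>F. c e) | W F. connected_subgraph N H W F \<and> A \<subseteq> W} \<subseteq> sum c ` Pow H"
    by (auto simp: connected_subgraph_def)
qed (use assms in simp)

lemma steiner_cost_le:
  assumes "finite H" "connected_subgraph N H W F" "A \<subseteq> W"
  shows "steiner_cost N H c A \<le> sum c F"
  unfolding steiner_cost_def using assms by (intro Min_le finite_steiner_costs) auto

text \<open>The witness \<open>W0\<close>, \<open>F0\<close> makes the set of costs nonempty;
  \<open>Min {}\<close> would be unspecified. Prim's tree supplies such witnesses later.\<close>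

lemma steiner_cost_attained:
  assumes "finite H" "connected_subgraph N H W0 F0" "A \<subseteq> W0"
  obtains W F where "connected_subgraph N H W F" "A \<subseteq> W" "steiner_cost N H c A = sum c F"
proof -
  have "steiner_cost N H c A
      \<in> {(\<Sum>e\<in>F. c e) | W F. connected_subgraph N H W F \<and> A \<subseteq> W}"
    unfolding steiner_cost_def using assms by (intro Min_in finite_steiner_costs) auto
  then show ?thesis using that by blast
qed

lemma steiner_cost_mono:
  assumes "finite H" "connected_subgraph N H W F" "B \<subseteq> W" "A \<subseteq> B"
  shows "steiner_cost N H c A \<le> steiner_cost N H c B"
proof -
  obtain W' F' where F': "connected_subgraph N H W' F'" "B \<subseteq> W'"
    "steiner_cost N H c B = sum c F'"
    by (rule steiner_cost_attained[OF assms(1-3)])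
  then show ?thesis using steiner_cost_le[OF assms(1) F'(1)] assms(4) by auto
qed

lemma connected_subgraph_mono:
  "connected_subgraph N H' W F \<Longrightarrow> H' \<subseteq> H \<Longrightarrow> connected_subgraph N H W F"
  by (auto simp: connected_subgraph_def)

lemma steiner_cost_antimono_edges:
  assumes "finite H" "H' \<subseteq> H" "connected_subgraph N H' W F" "A \<subseteq> W"
  shows "steiner_cost N H c A \<le> steiner_cost N H' c A"
proof -
  have "finite H'" using assms(2,1) by (rule finite_subset)
  then obtain W' F' where F': "connected_subgraph N H' W' F'" "A \<subseteq> W'"
    "steiner_cost N H' c A = sum c F'"
    using assms(3,4) by (rule steiner_cost_attained)
  then show ?thesis
    using steiner_cost_le[OF assms(1) connected_subgraph_mono[OF F'(1) assms(2)] F'(2)] by simp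
qed

text \<open>All edges of \<open>F\<close> lie inside \<open>W\<close>, so none contains
  \<open>i\<close> and none is among the deleted edges.\<close>

lemma connected_subgraph_avoiding:
  assumes "connected_subgraph N H W F" "\<And>e. e \<in> H - H' \<Longrightarrow> i \<in> e" "i \<notin> W"
  shows "connected_subgraph N H' W F"
  using assms unfolding connected_subgraph_def by blast

lemma steiner_marginal_antimono_edges:
  assumes "finite H" "H' \<subseteq> H" "\<And>e. e \<in> H - H' \<Longrightarrow> i \<in> e"
    and W0: "connected_subgraph N H' W0 F0" "insert i A \<subseteq> W0"
  shows "steiner_cost N H c (insert i A) - steiner_cost N H c A
       \<le> steiner_cost N H' c (insert i A) - steiner_cost N H' c A"
proof -
  have fin': "finite H'" using assms(2,1) by (rule finite_subset)
  have W0': "connected_subgraph N H W0 F0"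
    using W0(1) assms(2) by (rule connected_subgraph_mono)
  obtain W F where F: "connected_subgraph N H W F" "A \<subseteq> W" "steiner_cost N H c A = sum c F"
    by (rule steiner_cost_attained[OF assms(1) W0', of A]) (use W0(2) in auto)
  show ?thesis
  proof (cases "i \<in> W")
    case True
    \<comment> \<open>The two marginal costs are separated by 0: the one in \<open>H\<close> is at
      most 0, the one in \<open>H'\<close> at least 0.\<close>
    then have "steiner_cost N H c (insert i A) \<le> steiner_cost N H c A"
      using steiner_cost_le[OF assms(1) F(1)] F by simp
    moreover have "steiner_cost N H' c A \<le> steiner_cost N H' c (insert i A)"
      by (rule steiner_cost_mono[OF fin' W0]) blast
    ultimately show ?thesis by linarith
  next
    case False
    have "steiner_cost N H' c A \<le> steiner_cost N H c A"
      using steiner_cost_le[OF fin' connected_subgraph_avoiding[OF F(1) assms(3) False] F(2)] F(3)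
      by simp
    moreover have "steiner_cost N H c (insert i A) \<le> steiner_cost N H' c (insert i A)"
      using steiner_cost_antimono_edges[OF assms(1,2) W0] .
    ultimately show ?thesis by linarith
  qed
qed

text \<open>A path in \<open>F\<close> starting at \<open>s\<close> could leave \<open>U\<close>
  only along a cut edge of \<open>H\<close>.\<close>

lemma connected_subgraph_within_closed:
  assumes "connected_subgraph N H W F" "s \<in> W" "s \<in> U" "cut_edges H U = {}"
  shows "W \<subseteq> U"
proof
  fix w assume "w \<in> W"
  then have "(s, w) \<in> {(a, b). {a, b} \<in> F}\<^sup>*"
    using assms by (auto simp: connected_subgraph_def)
  then show "w \<in> U"
  proof (induction rule: rtrancl_induct)
    case (step y z)
    then have "{y, z} \<in> H" using assms(1) by (auto simp: connected_subgraph_def)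
    then show ?case using step assms(4) unfolding cut_edges_def by blast
  qed (rule assms)
qed

lemma prim_reach_source: "prim_reach H c s U T \<Longrightarrow> s \<in> U"
  by (induction rule: prim_reach.induct) auto

lemma prim_reach_connected_subgraph:
  assumes "prim_reach H c s U T" "\<Union>H \<subseteq> N" "s \<in> N"
  shows "connected_subgraph N H U T"
  using assms
proof (induction rule: prim_reach.induct)
  case start
  then show ?case by (auto simp: connected_subgraph_def)
next
  case (step U T u w)
  let ?r = "{(a, b). {a, b} \<in> T}" and ?r' = "{(a, b). {a, b} \<in> insert {u, w} T}"
  have IH: "connected_subgraph N H U T" using step by blast
  have old: "(a, b) \<in> ?r'\<^sup>*" if "a \<in> U" "b \<in> U" for a b
    using IH that rtrancl_mono[of ?r ?r'] unfolding connected_subgraph_def by blast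
  have new: "(u, w) \<in> ?r'" "(w, u) \<in> ?r'" by (auto simp: insert_commute)
  \<comment> \<open>The new node \<open>w\<close> is a leaf attached at \<open>u\<close>, so
    \<open>u\<close> serves as a hub through which any two nodes are joined.\<close>
  have "(a, u) \<in> ?r'\<^sup>*" "(u, a) \<in> ?r'\<^sup>*" if "a \<in> insert w U" for a
    using that old step.hyps(2) new by (auto intro: r_into_rtrancl)
  then have "(a, b) \<in> ?r'\<^sup>*" if "a \<in> insert w U" "b \<in> insert w U" for a b
    using that by (meson rtrancl_trans)
  moreover have "w \<in> N" using step by blast
  ultimately show ?case
    using IH step.hyps unfolding connected_subgraph_def by blast
qed

text \<open>Going from \<open>n\<close> to \<open>n + 1\<close> players multiplies the weight of a
  coalition of size \<open>k\<close> by \<open>(n - k) / (n + 1)\<close>, which is at most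
  1.\<close>

lemma shapley_weight_antimono:
  assumes "k < m" "m \<le> n"
  shows "fact k * fact (n - k - 1) / fact n \<le> (fact k * fact (m - k - 1) / fact m :: real)"
  using assms(2)
proof (induction n rule: dec_induct)
  case (step n)
  \<comment> \<open>Here \<open>k < m \<le> n\<close> keeps the natural-number subtraction from
    truncating.\<close>
  have "n - k = Suc (n - k - 1)" using step assms by simp
  then have "fact (Suc n - k - 1) = real (n - k) * fact (n - k - 1)"
    by (metis diff_Suc_1 diff_right_commute fact_Suc)
  then have "fact k * fact (Suc n - k - 1) / fact (Suc n)
      = (real (n - k) / real (Suc n)) * (fact k * fact (n - k - 1) / fact n :: real)"
    by (simp add: field_simps)
  also have "\<dots> \<le> 1 * (fact k * fact (n - k - 1) / fact n)"
    by (intro mult_right_mono) auto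
  finally show ?case using step by simp
qed simp

lemma induced_edges_subset: "induced_edges E \<theta> \<subseteq> E"
  by (auto simp: induced_edges_def)

lemma induced_edges_mono:
  assumes "\<And>j. \<theta>' j \<subseteq> \<theta> j"
  shows "induced_edges E \<theta>' \<subseteq> induced_edges E \<theta>"
  using assms unfolding induced_edges_def by blast

text \<open>An edge avoiding \<open>i\<close> is judged only by the reports of its endpoints, which
  the update at \<open>i\<close> leaves unchanged.\<close>

lemma induced_edges_fun_upd_diff:
  assumes "e \<in> induced_edges E (\<theta>(i := A)) - induced_edges E (\<theta>(i := B))"
  shows "i \<in> e"
proof (rule ccontr)
  assume "i \<notin> e"
  obtain u w where e: "e = {u, w}" "{u, w} \<in> E"
    "{u, w} \<in> (\<theta>(i := A)) u \<inter> (\<theta>(i := A)) w"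
    using assms unfolding induced_edges_def by blast
  then have "u \<noteq> i" "w \<noteq> i" using \<open>i \<notin> e\<close> by auto
  then have "{u, w} \<in> (\<theta>(i := B)) u \<inter> (\<theta>(i := B)) w" using e by simp
  then show False using assms e unfolding induced_edges_def by blast
qed

lemma fun_upd_in_profiles:
  assumes "\<theta> \<in> profiles_except V s E i" "A \<in> types E i" "i \<in> V"
  shows "\<theta>(i := A) \<in> profiles V s E"
  using assms unfolding profiles_def profiles_except_def
  by (auto simp: PiE_iff extensional_def)

theorem theorem4p2:
  fixes V :: "'a set" and s :: 'a and E :: "'a set set" and c :: "'a set \<Rightarrow> real"
    and g :: "('a \<Rightarrow> 'a set set) \<Rightarrow> 'a set"
    and f :: "('a \<Rightarrow> 'a set set) \<Rightarrow> 'a set set"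
    and x :: "'a \<Rightarrow> ('a \<Rightarrow> 'a set set) \<Rightarrow> real"
    and i :: 'a and \<theta>i \<theta>i' :: "'a set set" and \<theta>' :: "'a \<Rightarrow> 'a set set"
  assumes "weighted_graph V s E c"
    and "AMCM V s E c g f x"
    and "i \<in> V"
    and "\<theta>i \<in> types E i"
    and "\<theta>i' \<in> types E i"
    and "\<theta>i' \<subseteq> \<theta>i"
    and "\<theta>' \<in> profiles_except V s E i"
    and "i \<in> g (\<theta>'(i := \<theta>i)) \<inter> g (\<theta>'(i := \<theta>i'))"
  shows "x i (\<theta>'(i := \<theta>i)) \<le> x i (\<theta>'(i := \<theta>i'))"
proof -
  let ?t = "\<theta>'(i := \<theta>i)" and ?t' = "\<theta>'(i := \<theta>i')"
  let ?N = "insert s V"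
  let ?H = "induced_edges E ?t" and ?H' = "induced_edges E ?t'"
  let ?w = "\<lambda>n k. fact k * fact (n - k - 1) / fact n :: real"
  define m where
    "m = (\<lambda>\<theta> S. connection_cost V s E c \<theta> (insert i S) - connection_cost V s E c \<theta> S)"
  \<comment> \<open>Moving \<open>i\<close> outermost gives the shape of the marginal cost lemma,
    with terminal set \<open>insert s S\<close>.\<close>
  have m_eq: "m \<theta> S = steiner_cost ?N (induced_edges E \<theta>) c (insert i (insert s S))
      - steiner_cost ?N (induced_edges E \<theta>) c (insert s S)" for \<theta> S
    by (simp add: m_def connection_cost_eq_steiner_cost insert_commute)
  have EN: "\<Union>E \<subseteq> ?N" and finV: "finite V"
    using assms(1) unfolding weighted_graph_def by blast+
  have "finite E"
    by (rule finite_subset[of E "Pow ?N"]) (use EN finV in auto)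
  then have fin: "finite ?H" "finite ?H'"
    by (rule finite_subset[OF induced_edges_subset])+
  have HN: "\<Union>?H \<subseteq> ?N" "\<Union>?H' \<subseteq> ?N"
    using EN induced_edges_subset[of E] by blast+
  have sub: "?H' \<subseteq> ?H"
    by (rule induced_edges_mono) (use assms(6) in simp)
  have at_i: "i \<in> e" if "e \<in> ?H - ?H'" for e
    using that by (rule induced_edges_fun_upd_diff)
  have prof: "?t \<in> profiles V s E" "?t' \<in> profiles V s E"
    using assms(3-5,7) by (simp_all add: fun_upd_in_profiles)
  have AMCM: "(\<exists>U. prim_output (induced_edges E \<theta>) c s U (f \<theta>) \<and> g \<theta> = U - {s}) \<and>
      (i \<in> g \<theta> \<longrightarrow> x i \<theta> =
        (\<Sum>S\<in>Pow (g \<theta> - {i}). ?w (card (g \<theta>)) (card S) * m \<theta> S))"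
    if "\<theta> \<in> profiles V s E" for \<theta>
    using assms(2,3) that unfolding AMCM_def m_def by auto
  obtain U where U: "prim_output ?H c s U (f ?t)" "g ?t = U - {s}"
    using AMCM[OF prof(1)] by blast
  obtain U' where U': "prim_output ?H' c s U' (f ?t')" "g ?t' = U' - {s}"
    using AMCM[OF prof(2)] by blast
  have sU: "s \<in> U" "s \<in> U'"
    using U(1) U'(1) by (auto simp: prim_output_def dest: prim_reach_source)
  have conU: "connected_subgraph ?N ?H U (f ?t)" "connected_subgraph ?N ?H' U' (f ?t')"
    using U(1) U'(1) HN by (auto simp: prim_output_def intro: prim_reach_connected_subgraph)
  have cut: "cut_edges ?H U = {}" "cut_edges ?H' U' = {}"
    using U U' unfolding prim_output_def by auto
  have iU: "i \<in> U" "i \<in> U'" "i \<in> g ?t" "i \<in> g ?t'" using assms(8) U(2) U'(2) by auto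
  \<comment> \<open>The tree of the smaller graph is also connected in \<open>?H\<close>, where no
    edge leaves \<open>U\<close>.\<close>
  have "U' \<subseteq> U"
    using connected_subgraph_within_closed[OF connected_subgraph_mono[OF conU(2) sub]] sU cut
    by blast
  then have gsub: "g ?t' \<subseteq> g ?t" using U(2) U'(2) by auto
  have "U \<subseteq> ?N" using conU by (simp add: connected_subgraph_def)
  then have fing: "finite (g ?t)" "finite (g ?t')"
    using U(2) gsub finV by (auto intro: finite_subset)
  have nonneg: "0 \<le> m ?t S" if "S \<subseteq> g ?t" for S
    unfolding m_eq using that U(2) sU iU
    by (simp, intro steiner_cost_mono[OF fin(1) conU(1)]) auto
  have zero: "m ?t S = 0" if S: "S \<subseteq> g ?t" "\<not> S \<subseteq> g ?t'" for S
  proof -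
    obtain W F where F: "connected_subgraph ?N ?H W F" "insert s S \<subseteq> W"
      "steiner_cost ?N ?H c (insert s S) = sum c F"
      by (rule steiner_cost_attained[OF fin(1) conU(1), of "insert s S" c])
        (use S(1) U(2) sU in auto)
    \<comment> \<open>Avoiding \<open>i\<close>, the subgraph would survive in \<open>?H'\<close>
      and stay within \<open>U'\<close>, although \<open>S\<close> has a node outside
      \<open>U'\<close>.\<close>
    have "i \<in> W"
    proof (rule ccontr)
      assume "i \<notin> W"
      then have "W \<subseteq> U'"
        using connected_subgraph_within_closed[OF connected_subgraph_avoiding[OF F(1) at_i]]
          F(2) sU cut by blast
      then show False using S F(2) U(2) U'(2) by blast
    qed
    then have "m ?t S \<le> 0"
      unfolding m_eq using steiner_cost_le[OF fin(1) F(1)] F by simp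
    then show ?thesis using nonneg[OF S(1)] by simp
  qed
  have le: "m ?t S \<le> m ?t' S" if "S \<subseteq> g ?t'" for S
    unfolding m_eq using that U'(2) sU iU
    by (intro steiner_marginal_antimono_edges[OF fin(1) sub at_i conU(2)]) auto
  have "x i ?t = (\<Sum>S\<in>Pow (g ?t - {i}). ?w (card (g ?t)) (card S) * m ?t S)"
    using AMCM[OF prof(1)] iU by blast
  \<comment> \<open>Coalitions with a disconnected node drop out by \<open>zero\<close>; the weights
    are still those of the larger player set.\<close>
  also have "\<dots> = (\<Sum>S\<in>Pow (g ?t' - {i}). ?w (card (g ?t)) (card S) * m ?t S)"
  proof (rule sum.mono_neutral_right)
    show "\<forall>S\<in>Pow (g ?t - {i}) - Pow (g ?t' - {i}). ?w (card (g ?t)) (card S) * m ?t S = 0"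
      using zero by (auto simp: subset_Diff_insert)
  qed (use fing gsub in auto)
  also have "\<dots> \<le> (\<Sum>S\<in>Pow (g ?t' - {i}). ?w (card (g ?t')) (card S) * m ?t' S)"
  proof (rule sum_mono)
    fix S assume "S \<in> Pow (g ?t' - {i})"
    \<comment> \<open>The inclusion is strict because \<open>S\<close> misses \<open>i\<close>; this
      gives \<open>card S < card (g ?t')\<close> for the weight comparison.\<close>
    then have S: "S \<subseteq> g ?t'" "S \<subset> g ?t'" using iU by auto
    have "?w (card (g ?t)) (card S) \<le> ?w (card (g ?t')) (card S)"
      by (intro shapley_weight_antimono psubset_card_mono card_mono fing gsub S)
    \<comment> \<open>Both factors grow; \<open>nonneg\<close> is what lets the two inequalities be
      multiplied.\<close>
    then show "?w (card (g ?t)) (card S) * m ?t S \<le> ?w (card (g ?t')) (card S) * m ?t' S"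
      using le[OF S(1)] nonneg[of S] S gsub by (intro mult_mono) auto
  qed
  also have "\<dots> = x i ?t'"
    using AMCM[OF prof(2)] iU by simp
  finally show ?thesis .
qed

end
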